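(* Let $\mathcal{A}$ be a $C^*$-algebra and let $\mathcal{M}$ be a full Hilbert $\mathcal{A}$-module which is simple, in the sense that its only left $\mathcal{A}$-submodules are $\{0\}$ and $\mathcal{M}$. Let $\delta : D(\delta) \subseteq \mathcal{M} \to \mathcal{M}$ be a $d$-derivation. Then either $\delta$ is closable or the range of $\delta$ is dense in $\mathcal{M}$.
   Context: A Hilbert $\mathcal{A}$-module (Hilbert $C^*$-module over a $C^*$-algebra $\mathcal{A}$) is a left $\mathcal{A}$-module $\mathcal{M}$ equipped with an $\mathcal{A}$-valued inner product $\langle\cdot,\cdot\rangle$ (with the usual axioms), which is $\mathcal{A}$-linear in the first variable and conjugate linear in the second, such that $\mathcal{M}$ is a Banach space with respect to the norm $\|x\| = \|\langle x,x\rangle\|^{1/2}$. It is called full if the closed linear span of $\{\langle x,y\rangle : x,y \in \mathcal{M}\}$ is equal to $\mathcal{A}$. Let $\mathcal{M}$ be a full Hilbert $\mathcal{A}$-module. A linear map $\delta : D(\delta) \subseteq \mathcal{M} \to \mathcal{M}$, where $D(\delta)$ is a dense subspace of $\mathcal{M}$, is called a generalized derivation if there exists a mapping $d : D(d) \to \mathcal{A}$, where $D(d)$ is a dense subalgebra of $\mathcal{A}$, such that $D(\delta)$ is an algebraic left $D(d)$-module (i.e. $ax \in D(\delta)$ for all $a\in D(d)$, $x \in D(\delta)$) and $\delta(ax) = a\delta(x) + d(a)x$ for all $x \in D(\delta)$ and all $a \in D(d)$. In this case $\delta$ is called a $d$-derivation. The operator $\delta$ is closable if whenever $(x_n)$ is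 a sequence in $D(\delta)$ with $x_n \to 0$ and $\delta(x_n) \to x$ for some $x\in\mathcal{M}$, then $x = 0$. *)

theory Defs
  imports "HOL-Analysis.Analysis"
begin

section \<open>Complex normed spaces and C*-algebras\<close>

class complex_vector = real_vector +
  fixes scaleC :: "complex \<Rightarrow> 'a \<Rightarrow> 'a"  (infixr "*\<^sub>C" 75)
  assumes scaleC_add_right: "c *\<^sub>C (x + y) = c *\<^sub>C x + c *\<^sub>C y"
    and scaleC_add_left: "(b + c) *\<^sub>C x = b *\<^sub>C x + c *\<^sub>C x"
    and scaleC_scaleC: "b *\<^sub>C (c *\<^sub>C x) = (b * c) *\<^sub>C x"
    and scaleC_of_real: "complex_of_real r *\<^sub>C x = r *\<^sub>R x"

global_interpretation complex_vector: vector_space "scaleC :: complex \<Rightarrow> 'a \<Rightarrow> 'a::complex_vector"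
proof
  show "1 *\<^sub>C x = x" for x :: 'a
    using scaleC_of_real [of 1 x] by simp
qed (simp_all add: scaleC_add_right scaleC_add_left scaleC_scaleC)

abbreviation csubspace :: "'a::complex_vector set \<Rightarrow> bool"
  where "csubspace \<equiv> module.subspace scaleC"

abbreviation cspan :: "'a::complex_vector set \<Rightarrow> 'a set"
  where "cspan \<equiv> module.span scaleC"

class complex_normed_vector = complex_vector + real_normed_vector +
  assumes norm_scaleC: "norm (c *\<^sub>C x) = cmod c * norm x"

class complex_banach = complex_normed_vector + banach

text \<open>No unit is assumed.\<close>

class cstar_algebra = complex_banach + real_normed_algebra +
  fixes star :: "'a \<Rightarrow> 'a"
  assumes mult_scaleC_left: "(c *\<^sub>C x) * y = c *\<^sub>C (x * y)"
    and mult_scaleC_right: "x * (c *\<^sub>C y) = c *\<^sub>C (x * y)"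
    and star_add: "star (x + y) = star x + star y"
    and star_scaleC: "star (c *\<^sub>C x) = cnj c *\<^sub>C star x"
    and star_mult: "star (x * y) = star y * star x"
    and star_star: "star (star x) = x"
    and cstar_identity: "norm (star x * x) = (norm x)\<^sup>2"

text \<open>
  The elements \<open>b\<^sup>*b\<close> are exactly the self-adjoint elements with nonnegative spectrum.
\<close>

definition positive :: "'a::cstar_algebra \<Rightarrow> bool"
  where "positive a \<longleftrightarrow> (\<exists>b. a = star b * b)"

definition csubalgebra :: "'a::cstar_algebra set \<Rightarrow> bool"
  where "csubalgebra B \<longleftrightarrow> csubspace B \<and> (\<forall>a\<in>B. \<forall>b\<in>B. a * b \<in> B)"


section \<open>Hilbert modules\<close>

text \<open>
  Completeness in the norm \<open>\<parallel>x\<parallel> = \<parallel>\<langle>x,x\<rangle>\<parallel>\<^sup>1\<^sup>/\<^sup>2\<close> comes from the class \<open>complex_banach\<close> together with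
  the assumption \<open>norm_eq_ip\<close>. Conjugate linearity in the second variable follows from
  \<open>ip_star\<close>; see below.
\<close>

locale hilbert_module =
  fixes smul :: "'a::cstar_algebra \<Rightarrow> 'm::complex_banach \<Rightarrow> 'm"  (infixr "\<bullet>\<^sub>A" 75)
    and ip :: "'m \<Rightarrow> 'm \<Rightarrow> 'a"
  assumes smul_add_right: "a \<bullet>\<^sub>A (x + y) = a \<bullet>\<^sub>A x + a \<bullet>\<^sub>A y"
    and smul_add_left: "(a + b) \<bullet>\<^sub>A x = a \<bullet>\<^sub>A x + b \<bullet>\<^sub>A x"
    and smul_smul: "a \<bullet>\<^sub>A (b \<bullet>\<^sub>A x) = (a * b) \<bullet>\<^sub>A x"
    and smul_scaleC_left: "(c *\<^sub>C a) \<bullet>\<^sub>A x = c *\<^sub>C (a \<bullet>\<^sub>A x)"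
    and smul_scaleC_right: "a \<bullet>\<^sub>A (c *\<^sub>C x) = c *\<^sub>C (a \<bullet>\<^sub>A x)"
    and ip_add_left: "ip (x + y) z = ip x z + ip y z"
    and ip_scaleC_left: "ip (c *\<^sub>C x) y = c *\<^sub>C ip x y"
    and ip_smul_left: "ip (a \<bullet>\<^sub>A x) y = a * ip x y"
    and ip_star: "star (ip x y) = ip y x"
    and ip_positive: "positive (ip x x)"
    and ip_definite: "ip x x = 0 \<Longrightarrow> x = 0"
    and norm_eq_ip: "norm x = sqrt (norm (ip x x))"
begin

lemma ip_add_right: "ip x (y + z) = ip x y + ip x z"
  by (metis ip_add_left ip_star star_add)

lemma ip_scaleC_right: "ip x (c *\<^sub>C y) = cnj c *\<^sub>C ip x y"
  by (metis ip_scaleC_left ip_star star_scaleC)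

lemma ip_smul_right: "ip x (a \<bullet>\<^sub>A y) = ip x y * star a"
  by (metis ip_smul_left ip_star star_mult)

end

locale full_hilbert_module = hilbert_module +
  assumes full: "closure (cspan {ip x y |x y. True}) = UNIV"

definition left_submodule ::
    "('a::cstar_algebra \<Rightarrow> 'm::complex_banach \<Rightarrow> 'm) \<Rightarrow> 'm set \<Rightarrow> bool"
  where "left_submodule smul N \<longleftrightarrow> csubspace N \<and> (\<forall>a. \<forall>x\<in>N. smul a x \<in> N)"

text \<open>Submodules are not required to be closed, and \<open>\<M> = {0}\<close> is not excluded.\<close>

definition simple_module ::
    "('a::cstar_algebra \<Rightarrow> 'm::complex_banach \<Rightarrow> 'm) \<Rightarrow> bool"
  where "simple_module smul \<longleftrightarrow> (\<forall>N. left_submodule smul N \<longrightarrow> N = {0} \<or> N = UNIV)"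


section \<open>Generalized derivations\<close>

text \<open>
  A partially defined map is a total function together with its domain; values outside the
  domain are irrelevant.
\<close>

definition clinear_on :: "'m::complex_vector set \<Rightarrow> ('m \<Rightarrow> 'n::complex_vector) \<Rightarrow> bool"
  where "clinear_on D f \<longleftrightarrow>
    (\<forall>x\<in>D. \<forall>y\<in>D. f (x + y) = f x + f y) \<and> (\<forall>c. \<forall>x\<in>D. f (c *\<^sub>C x) = c *\<^sub>C f x)"

text \<open>The map \<open>d\<close> is an arbitrary function; neither linearity nor the Leibniz rule is assumed.\<close>

definition d_derivation ::
    "('a::cstar_algebra \<Rightarrow> 'm::complex_banach \<Rightarrow> 'm) \<Rightarrow>
     'a set \<Rightarrow> ('a \<Rightarrow> 'a) \<Rightarrow> 'm set \<Rightarrow> ('m \<Rightarrow> 'm) \<Rightarrow> bool"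
  where "d_derivation smul D\<^sub>d d D\<^sub>\<delta> \<delta> \<longleftrightarrow>
    csubspace D\<^sub>\<delta> \<and> closure D\<^sub>\<delta> = UNIV \<and> clinear_on D\<^sub>\<delta> \<delta> \<and>
    csubalgebra D\<^sub>d \<and> closure D\<^sub>d = UNIV \<and>
    (\<forall>a\<in>D\<^sub>d. \<forall>x\<in>D\<^sub>\<delta>. smul a x \<in> D\<^sub>\<delta> \<and> \<delta> (smul a x) = smul a (\<delta> x) + smul (d a) x)"

definition closable :: "'m::complex_normed_vector set \<Rightarrow> ('m \<Rightarrow> 'm) \<Rightarrow> bool"
  where "closable D \<delta> \<longleftrightarrow>
    (\<forall>\<xi> x. (\<forall>n. \<xi> n \<in> D) \<and> \<xi> \<longlonglongrightarrow> 0 \<and> (\<lambda>n. \<delta> (\<xi> n)) \<longlonglongrightarrow> x \<longrightarrow> x = 0)"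

end

theory Submission
  imports Defs
begin

text \<open>
  The separating space \<open>\<S>\<close> of \<open>\<delta>\<close>, i.e. the set of all limits of \<open>\<delta> (\<xi> n)\<close> with \<open>\<xi> n \<longlonglongrightarrow> 0\<close>, is a
  closed subspace. For \<open>a \<in> D\<^sub>d\<close> the terms \<open>d a \<xi> n\<close> vanish in the limit, so \<open>\<delta> (a \<xi> n)\<close> converges
  to \<open>a x\<close> and \<open>\<S>\<close> is stable under \<open>D\<^sub>d\<close>, hence, by density, under the whole algebra.
  Simplicity leaves \<open>\<S> = {0}\<close>, which is closability, or \<open>\<S> = \<M>\<close>, and \<open>\<S>\<close> is contained in the
  closure of the range.
\<close>

definition separating_space :: "'m::complex_normed_vector set \<Rightarrow> ('m \<Rightarrow> 'm) \<Rightarrow> 'm set"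
  where "separating_space D \<delta> =
    {x. \<exists>\<xi>. (\<forall>n. \<xi> n \<in> D) \<and> \<xi> \<longlonglongrightarrow> 0 \<and> (\<lambda>n. \<delta> (\<xi> n)) \<longlonglongrightarrow> x}"

lemma separating_spaceI:
  assumes "\<And>n. \<xi> n \<in> D" "\<xi> \<longlonglongrightarrow> 0" "(\<lambda>n. \<delta> (\<xi> n)) \<longlonglongrightarrow> x"
  shows "x \<in> separating_space D \<delta>"
  using assms unfolding separating_space_def by blast

lemma separating_spaceE:
  assumes "x \<in> separating_space D \<delta>"
  obtains \<xi> where "\<And>n. \<xi> n \<in> D" "\<xi> \<longlonglongrightarrow> 0" "(\<lambda>n. \<delta> (\<xi> n)) \<longlonglongrightarrow> x"
  using assms unfolding separating_space_def by blast

text \<open>An inclusion rather than an equality, because closability only says that every such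
  limit is 0. Equality with \<open>{0}\<close> would also assert that 0 is such a limit, which may
  fail for arbitrary \<open>D\<close> and \<delta>.\<close>

lemma closable_iff_separating_space: "closable D \<delta> \<longleftrightarrow> separating_space D \<delta> \<subseteq> {0}"
  unfolding closable_def separating_space_def by blast

lemma separating_space_subset_closure_range: "separating_space D \<delta> \<subseteq> closure (\<delta> ` D)"
proof
  fix x assume "x \<in> separating_space D \<delta>"
  then obtain \<xi> where "\<And>n. \<xi> n \<in> D" "(\<lambda>n. \<delta> (\<xi> n)) \<longlonglongrightarrow> x"
    by (rule separating_spaceE) blast
  then show "x \<in> closure (\<delta> ` D)"
    unfolding closure_sequential by (intro exI [of _ "\<lambda>n. \<delta> (\<xi> n)"]) auto
qed

text \<open>Convergence in the product is componentwise, so the separating space is the fibre over 0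
  of the closure of the graph. This form yields closedness at once, with no diagonal
  sequence.\<close>

lemma separating_space_eq_graph_section:
  "separating_space D \<delta> = Pair 0 -` closure ((\<lambda>y. (y, \<delta> y)) ` D)"
proof (intro set_eqI iffI)
  fix x assume "x \<in> separating_space D \<delta>"
  then obtain \<xi> where "\<And>n. \<xi> n \<in> D" "\<xi> \<longlonglongrightarrow> 0" "(\<lambda>n. \<delta> (\<xi> n)) \<longlonglongrightarrow> x"
    by (rule separating_spaceE) blast
  then have "\<forall>n. (\<xi> n, \<delta> (\<xi> n)) \<in> (\<lambda>y. (y, \<delta> y)) ` D" "(\<lambda>n. (\<xi> n, \<delta> (\<xi> n))) \<longlonglongrightarrow> (0, x)"
    by (auto intro: tendsto_Pair)
  then show "x \<in> Pair 0 -` closure ((\<lambda>y. (y, \<delta> y)) ` D)"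
    unfolding closure_sequential vimage_eq by fast
next
  fix x assume "x \<in> Pair 0 -` closure ((\<lambda>y. (y, \<delta> y)) ` D)"
  then obtain g where g: "\<And>n. g n \<in> (\<lambda>y. (y, \<delta> y)) ` D" "g \<longlonglongrightarrow> (0, x)"
    unfolding closure_sequential vimage_eq by blast
  \<comment> \<open>A point of the graph is determined by its first component, so the first
    components of \<open>g\<close> serve as the null sequence.\<close>
  have "fst (g n) \<in> D" "snd (g n) = \<delta> (fst (g n))" for n
    using g(1) [of n] by auto
  then show "x \<in> separating_space D \<delta>"
    using tendsto_fst [OF g(2)] tendsto_snd [OF g(2)]
    by (intro separating_spaceI [of "\<lambda>n. fst (g n)"]) simp_all
qed

lemma closed_separating_space: "closed (separating_space D \<delta>)"
  unfolding separating_space_eq_graph_section by (intro closed_vimage continuous_intros) simp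

lemma tendsto_scaleC:
  fixes f :: "'b \<Rightarrow> 'm::complex_normed_vector"
  assumes "(f \<longlongrightarrow> l) F"
  shows "((\<lambda>n. c *\<^sub>C f n) \<longlongrightarrow> c *\<^sub>C l) F"
proof -
  have "bounded_linear (\<lambda>x::'m. c *\<^sub>C x)"
  proof (rule bounded_linear_intro)
    \<comment> \<open>A real scalar acts as a complex one, and complex scalars commute.\<close>
    show "c *\<^sub>C (r *\<^sub>R x) = r *\<^sub>R (c *\<^sub>C x)" for r and x :: 'm
      by (metis mult.commute scaleC_of_real scaleC_scaleC)
    show "norm (c *\<^sub>C x) \<le> norm x * cmod c" for x :: 'm
      by (simp add: norm_scaleC)
  qed (rule scaleC_add_right)
  then show ?thesis
    using assms by (rule bounded_linear.tendsto)
qed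

text \<open>Witnessing sequences can be added and scaled termwise: they stay in \<open>D\<close> and
  tend to 0, and linearity of \<delta> carries the operations over to the limits.\<close>

lemma csubspace_separating_space:
  assumes "csubspace D" and lin: "clinear_on D \<delta>"
  shows "csubspace (separating_space D \<delta>)"
proof -
  have D: "0 \<in> D" "\<And>x y. x \<in> D \<Longrightarrow> y \<in> D \<Longrightarrow> x + y \<in> D" "\<And>c x. x \<in> D \<Longrightarrow> c *\<^sub>C x \<in> D"
    using assms(1) unfolding complex_vector.subspace_def by auto
  have \<delta>_add: "\<delta> (x + y) = \<delta> x + \<delta> y" if "x \<in> D" "y \<in> D" for x y
    using that lin unfolding clinear_on_def by blast
  have \<delta>_scaleC: "\<delta> (c *\<^sub>C x) = c *\<^sub>C \<delta> x" if "x \<in> D" for c x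
    using that lin unfolding clinear_on_def by blast
  show ?thesis
    unfolding complex_vector.subspace_def
  proof (intro conjI ballI allI)
    have "\<delta> 0 = 0"
      using \<delta>_add [OF D(1) D(1)] by simp
    then show "0 \<in> separating_space D \<delta>"
      using D(1) by (intro separating_spaceI [of "\<lambda>_. 0"]) auto
  next
    fix x y assume "x \<in> separating_space D \<delta>" "y \<in> separating_space D \<delta>"
    then obtain \<xi> \<eta> where
      \<xi>: "\<And>n. \<xi> n \<in> D" "\<xi> \<longlonglongrightarrow> 0" "(\<lambda>n. \<delta> (\<xi> n)) \<longlonglongrightarrow> x" and
      \<eta>: "\<And>n. \<eta> n \<in> D" "\<eta> \<longlonglongrightarrow> 0" "(\<lambda>n. \<delta> (\<eta> n)) \<longlonglongrightarrow> y"
      by (elim separating_spaceE) blast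
    show "x + y \<in> separating_space D \<delta>"
    proof (rule separating_spaceI)
      show "\<xi> n + \<eta> n \<in> D" for n
        by (intro D \<xi> \<eta>)
      show "(\<lambda>n. \<xi> n + \<eta> n) \<longlonglongrightarrow> 0"
        using tendsto_add [OF \<xi>(2) \<eta>(2)] by simp
      show "(\<lambda>n. \<delta> (\<xi> n + \<eta> n)) \<longlonglongrightarrow> x + y"
        using tendsto_add [OF \<xi>(3) \<eta>(3)] by (simp add: \<delta>_add \<xi>(1) \<eta>(1))
    qed
  next
    fix c x assume "x \<in> separating_space D \<delta>"
    then obtain \<xi> where \<xi>: "\<And>n. \<xi> n \<in> D" "\<xi> \<longlonglongrightarrow> 0" "(\<lambda>n. \<delta> (\<xi> n)) \<longlonglongrightarrow> x"
      by (rule separating_spaceE) blast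
    show "c *\<^sub>C x \<in> separating_space D \<delta>"
    proof (rule separating_spaceI)
      show "c *\<^sub>C \<xi> n \<in> D" for n
        by (intro D \<xi>)
      show "(\<lambda>n. c *\<^sub>C \<xi> n) \<longlonglongrightarrow> 0"
        using tendsto_scaleC [OF \<xi>(2), of c] by simp
      show "(\<lambda>n. \<delta> (c *\<^sub>C \<xi> n)) \<longlonglongrightarrow> c *\<^sub>C x"
        using tendsto_scaleC [OF \<xi>(3), of c] by (simp add: \<delta>_scaleC \<xi>(1))
    qed
  qed
qed

text \<open>The C*-identity and submultiplicativity give
  \<open>(norm b)\<^sup>2 \<le> norm (star b) * norm b\<close>. Cancelling \<open>norm b\<close>
  bounds \<open>norm b\<close> by \<open>norm (star b)\<close>; the same bound at
  \<open>star a\<close> gives the reverse inequality.\<close>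

lemma norm_star: "norm (star a) = norm (a::'a::cstar_algebra)"
proof -
  have le: "norm b \<le> norm (star b)" for b :: 'a
  proof (cases "b = 0")
    case False
    have "norm b * norm b \<le> norm (star b) * norm b"
      using norm_mult_ineq [of "star b" b] by (simp add: cstar_identity power2_eq_square)
    with False show ?thesis
      by simp
  qed simp
  show ?thesis
    using le [of a] le [of "star a"] by (simp add: star_star)
qed

context hilbert_module
begin

text \<open>Pulling \<open>a\<close> out of both slots turns the inner square of
  \<open>a \<bullet>\<^sub>A x\<close> into \<open>a * ip x x * star a\<close>. Submultiplicativity
  and the isometry of \<open>star\<close> bound its norm by
  \<open>(norm a)\<^sup>2 * norm (ip x x)\<close>, and square roots finish.\<close>

lemma norm_smul_le: "norm (a \<bullet>\<^sub>A x) \<le> norm a * norm x"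
proof -
  have "norm (ip (a \<bullet>\<^sub>A x) (a \<bullet>\<^sub>A x)) = norm (a * ip x x * star a)"
    by (simp add: ip_smul_left ip_smul_right mult.assoc)
  also have "\<dots> \<le> norm (a * ip x x) * norm (star a)"
    by (rule norm_mult_ineq)
  also have "\<dots> \<le> norm a * norm (ip x x) * norm a"
    unfolding norm_star by (intro mult_right_mono norm_mult_ineq norm_ge_zero)
  also have "\<dots> = (norm a)\<^sup>2 * norm (ip x x)"
    by (simp add: power2_eq_square)
  finally have "norm (a \<bullet>\<^sub>A x) \<le> sqrt ((norm a)\<^sup>2 * norm (ip x x))"
    unfolding norm_eq_ip [of "a \<bullet>\<^sub>A x"] by (rule real_sqrt_le_mono)
  then show ?thesis
    by (simp add: norm_eq_ip [of x] real_sqrt_mult)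
qed

text \<open>Supplies continuity of the action in both variables: in the module variable for limits
  along a null sequence, in the algebra variable for the passage from \<open>D\<^sub>d\<close> to
  its closure.\<close>

lemma bounded_bilinear_smul: "bounded_bilinear (\<bullet>\<^sub>A)"
proof
  show "(r *\<^sub>R a) \<bullet>\<^sub>A x = r *\<^sub>R (a \<bullet>\<^sub>A x)" for r a x
    by (metis scaleC_of_real smul_scaleC_left)
  show "a \<bullet>\<^sub>A (r *\<^sub>R x) = r *\<^sub>R (a \<bullet>\<^sub>A x)" for r a x
    by (metis scaleC_of_real smul_scaleC_right)
  show "\<exists>K. \<forall>a x. norm (a \<bullet>\<^sub>A x) \<le> norm a * norm x * K"
    by (rule exI [of _ 1]) (simp add: norm_smul_le)
qed (simp_all add: smul_add_left smul_add_right)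

lemma left_submodule_separating_space:
  assumes "d_derivation (\<bullet>\<^sub>A) D\<^sub>d d D\<^sub>\<delta> \<delta>"
  shows "left_submodule (\<bullet>\<^sub>A) (separating_space D\<^sub>\<delta> \<delta>)"
proof -
  interpret smul: bounded_bilinear "(\<bullet>\<^sub>A)"
    by (rule bounded_bilinear_smul)
  have sub: "csubspace D\<^sub>\<delta>" and lin: "clinear_on D\<^sub>\<delta> \<delta>" and dense: "closure D\<^sub>d = UNIV"
    and mem: "\<And>a x. a \<in> D\<^sub>d \<Longrightarrow> x \<in> D\<^sub>\<delta> \<Longrightarrow> a \<bullet>\<^sub>A x \<in> D\<^sub>\<delta>"
    and deriv: "\<And>a x. a \<in> D\<^sub>d \<Longrightarrow> x \<in> D\<^sub>\<delta> \<Longrightarrow> \<delta> (a \<bullet>\<^sub>A x) = a \<bullet>\<^sub>A \<delta> x + d a \<bullet>\<^sub>A x"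
    using assms unfolding d_derivation_def by auto
  have "a \<bullet>\<^sub>A x \<in> separating_space D\<^sub>\<delta> \<delta>" if x: "x \<in> separating_space D\<^sub>\<delta> \<delta>" for a x
  proof -
    \<comment> \<open>With \<open>x\<close> fixed, the algebra elements that keep \<open>x\<close>
      in the separating space are collected; it suffices that they form a closed set containing the
      dense set \<open>D\<^sub>d\<close>.\<close>
    let ?T = "{a. a \<bullet>\<^sub>A x \<in> separating_space D\<^sub>\<delta> \<delta>}"
    obtain \<xi> where \<xi>: "\<And>n. \<xi> n \<in> D\<^sub>\<delta>" "\<xi> \<longlonglongrightarrow> 0" "(\<lambda>n. \<delta> (\<xi> n)) \<longlonglongrightarrow> x"
      using x by (rule separating_spaceE) blast
    have "D\<^sub>d \<subseteq> ?T"
    proof (intro subsetI CollectI)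
      fix b assume b: "b \<in> D\<^sub>d"
      show "b \<bullet>\<^sub>A x \<in> separating_space D\<^sub>\<delta> \<delta>"
      proof (rule separating_spaceI)
        show "b \<bullet>\<^sub>A \<xi> n \<in> D\<^sub>\<delta>" for n
          by (intro mem b \<xi>)
        show "(\<lambda>n. b \<bullet>\<^sub>A \<xi> n) \<longlonglongrightarrow> 0"
          using smul.tendsto [OF tendsto_const \<xi>(2), of b] by (simp add: smul.zero_right)
        \<comment> \<open>As \<open>b\<close> does not vary with \<open>n\<close>,
          \<open>d b\<close> is one fixed element, and acting by it preserves convergence to
          0.\<close>
        have "(\<lambda>n. b \<bullet>\<^sub>A \<delta> (\<xi> n) + d b \<bullet>\<^sub>A \<xi> n) \<longlonglongrightarrow> b \<bullet>\<^sub>A x + d b \<bullet>\<^sub>A 0"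
          by (intro tendsto_add smul.tendsto tendsto_const \<xi>)
        then show "(\<lambda>n. \<delta> (b \<bullet>\<^sub>A \<xi> n)) \<longlonglongrightarrow> b \<bullet>\<^sub>A x"
          by (simp add: deriv b \<xi>(1) smul.zero_right)
      qed
    qed
    moreover have "closed ?T"
    proof -
      \<comment> \<open>Here \<open>x\<close> is fixed and the action is continuous in
        \<open>a\<close>, so the preimage of the closed separating space is closed.\<close>
      have "closed ((\<lambda>a. a \<bullet>\<^sub>A x) -` separating_space D\<^sub>\<delta> \<delta>)"
        by (intro closed_vimage closed_separating_space smul.continuous_on continuous_on_id
            continuous_on_const)
      then show ?thesis
        by (simp add: vimage_def)
    qed
    ultimately have "closure D\<^sub>d \<subseteq> ?T"
      by (rule closure_minimal)
    with dense show ?thesis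
      by auto
  qed
  with csubspace_separating_space [OF sub lin] show ?thesis
    unfolding left_submodule_def by blast
qed

end

theorem theorem3p2:
  fixes smul :: "'a::cstar_algebra \<Rightarrow> 'm::complex_banach \<Rightarrow> 'm"
    and ip :: "'m \<Rightarrow> 'm \<Rightarrow> 'a"
    and D\<^sub>d :: "'a set" and d :: "'a \<Rightarrow> 'a"
    and D\<^sub>\<delta> :: "'m set" and \<delta> :: "'m \<Rightarrow> 'm"
  assumes "full_hilbert_module smul ip"
    and "simple_module smul"
    and "d_derivation smul D\<^sub>d d D\<^sub>\<delta> \<delta>"
  shows "closable D\<^sub>\<delta> \<delta> \<or> closure (\<delta> ` D\<^sub>\<delta>) = UNIV"
proof -
  interpret full_hilbert_module smul ip
    by fact
  have "separating_space D\<^sub>\<delta> \<delta> = {0} \<or> separating_space D\<^sub>\<delta> \<delta> = UNIV"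
    using left_submodule_separating_space [OF assms(3)] assms(2)
    unfolding simple_module_def by blast
  then show ?thesis
    using separating_space_subset_closure_range [of D\<^sub>\<delta> \<delta>]
    by (auto simp: closable_iff_separating_space)
qed

end
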